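(* Let $0\to(\mathfrak{h},[~,~]_\mathfrak{h},S)\xrightarrow{i}(\mathfrak{e},[~,~]_\mathfrak{e},U)\xrightarrow{p}(\mathfrak{g},[~,~]_\mathfrak{g},N)\to0$ be a non-abelian extension of Nijenhuis Lie algebras. Then there is an exact sequence $$1\to\mathrm{Aut}_{\mathfrak{h},\mathfrak{g}}(\mathfrak{e},U)\hookrightarrow\mathrm{Aut}_\mathfrak{h}(\mathfrak{e},U)\xrightarrow{\tau}\mathrm{Aut}(\mathfrak{h},S)\times\mathrm{Aut}(\mathfrak{g},N)\xrightarrow{\mathcal{W}}H^2_{nab}((\mathfrak{g},N);(\mathfrak{h},S)),$$ where $\mathrm{Aut}_{\mathfrak{h},\mathfrak{g}}(\mathfrak{e},U)=\{\gamma\in\mathrm{Aut}_\mathfrak{h}(\mathfrak{e},U)\mid\tau(\gamma)=(\mathrm{Id}_\mathfrak{h},\mathrm{Id}_\mathfrak{g})\}$ and the first map is the inclusion. That is: the inclusion is injective, its image is $\ker\tau$, and the image of $\tau$ equals $\{(\beta,\alpha)\mid\mathcal{W}(\beta,\alpha)=0\}$.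
   Context: All vector spaces are over a fixed field. A Nijenhuis operator on a Lie algebra $(\mathfrak{g},[~,~]_\mathfrak{g})$ is a linear map $N:\mathfrak{g}\to\mathfrak{g}$ with $[N(x),N(y)]_\mathfrak{g}=N([N(x),y]_\mathfrak{g}+[x,N(y)]_\mathfrak{g}-N[x,y]_\mathfrak{g})$ for all $x,y\in\mathfrak{g}$. A Nijenhuis Lie algebra $(\mathfrak{g},[~,~]_\mathfrak{g},N)$ is a Lie algebra with a Nijenhuis operator. A homomorphism of Nijenhuis Lie algebras is a Lie algebra homomorphism commuting with the Nijenhuis operators; $\mathrm{Aut}(\mathfrak{g},N)$ is the group of (bijective) Nijenhuis Lie algebra automorphisms. A non-abelian extension is a short exact sequence of Nijenhuis Lie algebras $0\to\mathfrak{h}\xrightarrow{i}\mathfrak{e}\xrightarrow{p}\mathfrak{g}\to0$; $\mathfrak{h}$ is identified with $i(\mathfrak{h})\subset\mathfrak{e}$. A section of $p$ is a linear map $s:\mathfrak{g}\to\mathfrak{e}$ with $ps=\mathrm{Id}_\mathfrak{g}$. $\mathrm{Aut}_\mathfrak{h}(\mathfrak{e},U)$ is the group of all $\gamma\in\mathrm{Aut}(\mathfrak{e},U)$ with $\gamma(\mathfrak{h})=\mathfrak{h}$. The group homomorphism $\tau:\mathrm{Aut}_\mathfrak{h}(\mathfrak{e},U)\to\mathrm{Aut}(\mathfrak{h},S)\times\mathrm{Aut}(\mathfrak{g},N)$ is $\tau(\gamma)=(\gamma|_\mathfrak{h},\overline{\gamma})$ with $\overline{\gamma}=p\gamma s$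 for any section $s$ (independent of $s$). Non-abelian 2-cocycles: a non-abelian 2-cocycle of $(\mathfrak{g},N)$ with values in $(\mathfrak{h},S)$ is a triple $(\chi,\psi,F)$ of linear maps $\chi:\wedge^2\mathfrak{g}\to\mathfrak{h}$, $\psi:\mathfrak{g}\to\mathrm{Der}(\mathfrak{h})$, $F:\mathfrak{g}\to\mathfrak{h}$ such that for all $x,y,z\in\mathfrak{g}$, $h\in\mathfrak{h}$: (1) $\psi_x\psi_y(h)-\psi_y\psi_x(h)-\psi_{[x,y]_\mathfrak{g}}(h)=[\chi(x,y),h]_\mathfrak{h}$; (2) $\psi_x\chi(y,z)+\psi_y\chi(z,x)+\psi_z\chi(x,y)-\chi([x,y]_\mathfrak{g},z)-\chi([y,z]_\mathfrak{g},x)-\chi([z,x]_\mathfrak{g},y)=0$; (3) $\psi_{N(x)}S(h)=S(\psi_{N(x)}h+\psi_xS(h)-S(\psi_xh))+S[F(x),h]_\mathfrak{h}-[F(x),S(h)]_\mathfrak{h}$; (4) $\chi(N(x),N(y))-S(\chi(N(x),y)+\chi(x,N(y))-S(\chi(x,y)))-F([N(x),y]_\mathfrak{g}+[x,N(y)]_\mathfrak{g}-N[x,y]_\mathfrak{g})+\psi_{N(x)}F(y)-\psi_{N(y)}F(x)-S(\psi_xF(y)-\psi_yF(x)-F[x,y]_\mathfrak{g})+[F(x),F(y)]_\mathfrak{h}=0$. $(\chi,\psi,F)$ and $(\chi',\psi',F')$ are equivalent if there is a linear map $\varphi:\mathfrak{g}\to\mathfrak{h}$ with, for all $x,y\in\mathfrak{g}$,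 $h\in\mathfrak{h}$: $\psi_xh-\psi'_xh=[\varphi(x),h]_\mathfrak{h}$; $\chi(x,y)-\chi'(x,y)=\psi'_x(\varphi(y))-\psi'_y(\varphi(x))-\varphi([x,y]_\mathfrak{g})+[\varphi(x),\varphi(y)]_\mathfrak{h}$; $F(x)-F'(x)=S(\varphi(x))-\varphi(N(x))$. $H^2_{nab}((\mathfrak{g},N);(\mathfrak{h},S))$ is the set of equivalence classes. Given a section $s$, the associated non-abelian 2-cocycle of the extension is $\chi(x,y)=[s(x),s(y)]_\mathfrak{e}-s[x,y]_\mathfrak{g}$, $\psi_xh=[s(x),h]_\mathfrak{e}$, $F(x)=(Us-sN)(x)$. For a pair $(\beta,\alpha)$, set $\chi_{(\beta,\alpha)}(x,y)=\beta\chi(\alpha^{-1}(x),\alpha^{-1}(y))$, $(\psi_{(\beta,\alpha)})_xh=\beta(\psi_{\alpha^{-1}(x)}\beta^{-1}(h))$, $F_{(\beta,\alpha)}(x)=\beta(F(\alpha^{-1}(x)))$; this is again a non-abelian 2-cocycle. The Wells map is denoted $\mathcal{W}(\beta,\alpha):=[(\chi_{(\beta,\alpha)},\psi_{(\beta,\alpha)},F_{(\beta,\alpha)})-(\chi,\psi,F)]$, where $\mathcal{W}(\beta,\alpha)=0$ means that $(\chi_{(\beta,\alpha)},\psi_{(\beta,\alpha)},F_{(\beta,\alpha)})$ and $(\chi,\psi,F)$ are equivalent non-abelian 2-cocycles (a condition independent of the section $s$). *)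

theory Defs
  imports Complex_Main "HOL-Algebra.Coset"
begin

text \<open>A vector space is a type of class \<^class>\<open>ab_group_add\<close> with a scalar multiplication, as in
  \<^theory>\<open>HOL.Vector_Spaces\<close>. The record bundles the data of a Nijenhuis Lie algebra.\<close>

record ('k, 'a) nij_lie =
  scl :: "'k \<Rightarrow> 'a \<Rightarrow> 'a"
  lie :: "'a \<Rightarrow> 'a \<Rightarrow> 'a"
  nij :: "'a \<Rightarrow> 'a"

abbreviation linear_map ::
  "('k::field, 'a::ab_group_add) nij_lie \<Rightarrow> ('k, 'b::ab_group_add) nij_lie \<Rightarrow> ('a \<Rightarrow> 'b) \<Rightarrow> bool"
  where "linear_map L M f \<equiv> Vector_Spaces.linear (scl L) (scl M) f"

text \<open>A linear map on the exterior square is the same as an alternating bilinear map.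
  Since the field is arbitrary, alternating (and not only antisymmetric) is required.\<close>

definition alternating_bilinear ::
  "('k::field, 'a::ab_group_add) nij_lie \<Rightarrow> ('k, 'b::ab_group_add) nij_lie \<Rightarrow> ('a \<Rightarrow> 'a \<Rightarrow> 'b) \<Rightarrow> bool"
  where "alternating_bilinear L M f \<longleftrightarrow>
    (\<forall>x. linear_map L M (f x)) \<and> (\<forall>y. linear_map L M (\<lambda>x. f x y)) \<and> (\<forall>x. f x x = 0)"

definition lie_algebra :: "('k::field, 'a::ab_group_add) nij_lie \<Rightarrow> bool"
  where "lie_algebra L \<longleftrightarrow>
    Vector_Spaces.vector_space (scl L) \<and>
    alternating_bilinear L L (lie L) \<and>
    (\<forall>x y z. lie L x (lie L y z) + lie L y (lie L z x) + lie L z (lie L x y) = 0)"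

definition nijenhuis_operator :: "('k::field, 'a::ab_group_add) nij_lie \<Rightarrow> ('a \<Rightarrow> 'a) \<Rightarrow> bool"
  where "nijenhuis_operator L N \<longleftrightarrow>
    linear_map L L N \<and>
    (\<forall>x y. lie L (N x) (N y) = N (lie L (N x) y + lie L x (N y) - N (lie L x y)))"

definition nijenhuis_lie_algebra :: "('k::field, 'a::ab_group_add) nij_lie \<Rightarrow> bool"
  where "nijenhuis_lie_algebra L \<longleftrightarrow> lie_algebra L \<and> nijenhuis_operator L (nij L)"

definition nij_lie_hom ::
  "('k::field, 'a::ab_group_add) nij_lie \<Rightarrow> ('k, 'b::ab_group_add) nij_lie \<Rightarrow> ('a \<Rightarrow> 'b) \<Rightarrow> bool"
  where "nij_lie_hom L M f \<longleftrightarrow>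
    linear_map L M f \<and>
    (\<forall>x y. f (lie L x y) = lie M (f x) (f y)) \<and>
    (\<forall>x. f (nij L x) = nij M (f x))"

definition nij_extension ::
  "('k::field, 'h::ab_group_add) nij_lie \<Rightarrow> ('k, 'e::ab_group_add) nij_lie \<Rightarrow>
   ('k, 'g::ab_group_add) nij_lie \<Rightarrow> ('h \<Rightarrow> 'e) \<Rightarrow> ('e \<Rightarrow> 'g) \<Rightarrow> bool"
  where "nij_extension H E G i p \<longleftrightarrow>
    nijenhuis_lie_algebra H \<and> nijenhuis_lie_algebra E \<and> nijenhuis_lie_algebra G \<and>
    nij_lie_hom H E i \<and> nij_lie_hom E G p \<and>
    inj i \<and> surj p \<and> range i = {e. p e = 0}"

definition section_of ::
  "('k::field, 'e::ab_group_add) nij_lie \<Rightarrow> ('k, 'g::ab_group_add) nij_lie \<Rightarrow>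
   ('e \<Rightarrow> 'g) \<Rightarrow> ('g \<Rightarrow> 'e) \<Rightarrow> bool"
  where "section_of E G p s \<longleftrightarrow> linear_map G E s \<and> p \<circ> s = id"

definition composition_monoid :: "('a \<Rightarrow> 'a) set \<Rightarrow> ('a \<Rightarrow> 'a) monoid"
  where "composition_monoid A = \<lparr>carrier = A, monoid.mult = (\<circ>), one = id\<rparr>"

definition Aut :: "('k::field, 'a::ab_group_add) nij_lie \<Rightarrow> ('a \<Rightarrow> 'a) monoid"
  where "Aut L = composition_monoid {\<gamma>. nij_lie_hom L L \<gamma> \<and> bij \<gamma>}"

text \<open>The kernel algebra is identified with \<^term>\<open>range i\<close>.\<close>

definition Aut_h :: "('k::field, 'e::ab_group_add) nij_lie \<Rightarrow> ('h \<Rightarrow> 'e) \<Rightarrow> ('e \<Rightarrow> 'e) monoid"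
  where "Aut_h E i = composition_monoid {\<gamma> \<in> carrier (Aut E). \<gamma> ` range i = range i}"

text \<open>Under this identification the restriction of \<open>\<gamma>\<close> becomes the conjugate of \<open>\<gamma>\<close> by \<open>i\<close>.\<close>

definition tau ::
  "('h \<Rightarrow> 'e) \<Rightarrow> ('e \<Rightarrow> 'g) \<Rightarrow> ('g \<Rightarrow> 'e) \<Rightarrow> ('e \<Rightarrow> 'e) \<Rightarrow> ('h \<Rightarrow> 'h) \<times> ('g \<Rightarrow> 'g)"
  where "tau i p s \<gamma> = (the_inv i \<circ> \<gamma> \<circ> i, p \<circ> \<gamma> \<circ> s)"

definition Aut_hg ::
  "('k::field, 'e::ab_group_add) nij_lie \<Rightarrow> ('h \<Rightarrow> 'e) \<Rightarrow> ('e \<Rightarrow> 'g) \<Rightarrow> ('g \<Rightarrow> 'e) \<Rightarrow> ('e \<Rightarrow> 'e) monoid"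
  where "Aut_hg E i p s = composition_monoid {\<gamma> \<in> carrier (Aut_h E i). tau i p s \<gamma> = (id, id)}"

definition derivation :: "('k::field, 'h::ab_group_add) nij_lie \<Rightarrow> ('h \<Rightarrow> 'h) \<Rightarrow> bool"
  where "derivation H D \<longleftrightarrow>
    linear_map H H D \<and> (\<forall>a b. D (lie H a b) = lie H (D a) b + lie H a (D b))"

type_synonym ('g, 'h) cochain = "('g \<Rightarrow> 'g \<Rightarrow> 'h) \<times> ('g \<Rightarrow> 'h \<Rightarrow> 'h) \<times> ('g \<Rightarrow> 'h)"

definition nab_cocycles ::
  "('k::field, 'g::ab_group_add) nij_lie \<Rightarrow> ('k, 'h::ab_group_add) nij_lie \<Rightarrow> ('g, 'h) cochain set"
  where "nab_cocycles G H = {(\<chi>, \<psi>, F).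
    alternating_bilinear G H \<chi> \<and>
    (\<forall>x. derivation H (\<psi> x)) \<and> (\<forall>h. linear_map G H (\<lambda>x. \<psi> x h)) \<and>
    linear_map G H F \<and>
    (\<forall>x y h. \<psi> x (\<psi> y h) - \<psi> y (\<psi> x h) - \<psi> (lie G x y) h = lie H (\<chi> x y) h) \<and>
    (\<forall>x y z. \<psi> x (\<chi> y z) + \<psi> y (\<chi> z x) + \<psi> z (\<chi> x y)
      - \<chi> (lie G x y) z - \<chi> (lie G y z) x - \<chi> (lie G z x) y = 0) \<and>
    (\<forall>x h. \<psi> (nij G x) (nij H h) =
      nij H (\<psi> (nij G x) h + \<psi> x (nij H h) - nij H (\<psi> x h))
      + nij H (lie H (F x) h) - lie H (F x) (nij H h)) \<and>
    (\<forall>x y. \<chi> (nij G x) (nij G y)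
      - nij H (\<chi> (nij G x) y + \<chi> x (nij G y) - nij H (\<chi> x y))
      - F (lie G (nij G x) y + lie G x (nij G y) - nij G (lie G x y))
      + \<psi> (nij G x) (F y) - \<psi> (nij G y) (F x)
      - nij H (\<psi> x (F y) - \<psi> y (F x) - F (lie G x y))
      + lie H (F x) (F y) = 0)}"

definition nab_equiv ::
  "('k::field, 'g::ab_group_add) nij_lie \<Rightarrow> ('k, 'h::ab_group_add) nij_lie \<Rightarrow>
   (('g, 'h) cochain \<times> ('g, 'h) cochain) set"
  where "nab_equiv G H = {((\<chi>, \<psi>, F), (\<chi>', \<psi>', F')).
    (\<chi>, \<psi>, F) \<in> nab_cocycles G H \<and> (\<chi>', \<psi>', F') \<in> nab_cocycles G H \<and>
    (\<exists>\<phi>. linear_map G H \<phi> \<and>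
      (\<forall>x h. \<psi> x h - \<psi>' x h = lie H (\<phi> x) h) \<and>
      (\<forall>x y. \<chi> x y - \<chi>' x y =
        \<psi>' x (\<phi> y) - \<psi>' y (\<phi> x) - \<phi> (lie G x y) + lie H (\<phi> x) (\<phi> y)) \<and>
      (\<forall>x. F x - F' x = nij H (\<phi> x) - \<phi> (nij G x)))}"

definition H2_nab ::
  "('k::field, 'g::ab_group_add) nij_lie \<Rightarrow> ('k, 'h::ab_group_add) nij_lie \<Rightarrow> ('g, 'h) cochain set set"
  where "H2_nab G H = nab_cocycles G H // nab_equiv G H"

definition nab_class ::
  "('k::field, 'g::ab_group_add) nij_lie \<Rightarrow> ('k, 'h::ab_group_add) nij_lie \<Rightarrow>
   ('g, 'h) cochain \<Rightarrow> ('g, 'h) cochain set"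
  where "nab_class G H c = nab_equiv G H `` {c}"

text \<open>The three expressions below lie in \<^term>\<open>range i\<close>.\<close>

definition ext_cocycle ::
  "('k::field, 'e::ab_group_add) nij_lie \<Rightarrow> ('k, 'g::ab_group_add) nij_lie \<Rightarrow>
   ('h \<Rightarrow> 'e) \<Rightarrow> ('g \<Rightarrow> 'e) \<Rightarrow> ('g, 'h) cochain"
  where "ext_cocycle E G i s =
    ((\<lambda>x y. the_inv i (lie E (s x) (s y) - s (lie G x y))),
     (\<lambda>x h. the_inv i (lie E (s x) (i h))),
     (\<lambda>x. the_inv i (nij E (s x) - s (nij G x))))"

definition twist :: "('h \<Rightarrow> 'h) \<times> ('g \<Rightarrow> 'g) \<Rightarrow> ('g, 'h) cochain \<Rightarrow> ('g, 'h) cochain"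
  where "twist = (\<lambda>(\<beta>, \<alpha>) (\<chi>, \<psi>, F).
    ((\<lambda>x y. \<beta> (\<chi> (inv_into UNIV \<alpha> x) (inv_into UNIV \<alpha> y))),
     (\<lambda>x h. \<beta> (\<psi> (inv_into UNIV \<alpha> x) (inv_into UNIV \<beta> h))),
     (\<lambda>x. \<beta> (F (inv_into UNIV \<alpha> x)))))"

text \<open>The target of the Wells map carries no subtraction, so the difference in the usual notation
  \<open>\<W>(\<beta>, \<alpha>) = [twisted cocycle - cocycle]\<close> is formal. The target is treated as a set pointed by
  the class of the cocycle of the extension (\<open>wells_zero\<close>), and the Wells map
  sends \<open>(\<beta>, \<alpha>)\<close> to the class of the twisted cocycle; it vanishes when it hits the base point.\<close>

definition wells ::
  "('k::field, 'h::ab_group_add) nij_lie \<Rightarrow> ('k, 'e::ab_group_add) nij_lie \<Rightarrow>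
   ('k, 'g::ab_group_add) nij_lie \<Rightarrow> ('h \<Rightarrow> 'e) \<Rightarrow> ('g \<Rightarrow> 'e) \<Rightarrow>
   ('h \<Rightarrow> 'h) \<times> ('g \<Rightarrow> 'g) \<Rightarrow> ('g, 'h) cochain set"
  where "wells H E G i s ba = nab_class G H (twist ba (ext_cocycle E G i s))"

definition wells_zero ::
  "('k::field, 'h::ab_group_add) nij_lie \<Rightarrow> ('k, 'e::ab_group_add) nij_lie \<Rightarrow>
   ('k, 'g::ab_group_add) nij_lie \<Rightarrow> ('h \<Rightarrow> 'e) \<Rightarrow> ('g \<Rightarrow> 'e) \<Rightarrow> ('g, 'h) cochain set"
  where "wells_zero H E G i s = nab_class G H (ext_cocycle E G i s)"

end

theory Submission
  imports Defs
begin

text \<open>The whole proof rests on one observation: the non-abelian 2-cocycles equivalent to the cocycle of a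
  section \<open>s\<close> are precisely the cocycles of all the sections of \<open>p\<close>. Indeed two sections differ by
  \<open>i \<circ> \<phi>\<close> for a linear \<open>\<phi> : \<gg> \<rightarrow> \<hh>\<close>, and replacing \<open>s\<close> by \<open>s + i \<circ> \<phi>\<close> changes the cocycle by
  exactly the three formulas that define equivalence (\<open>ext_cocycle_shift\<close>,
  \<open>equivalent_cocycle_iff\<close>). The Wells class of \<open>(\<beta>, \<alpha>)\<close> therefore vanishes if and only if the
  twisted cocycle is the cocycle of some other section \<open>t\<close>.

  This makes both halves of exactness at \<open>Aut(\<hh>, S) \<times> Aut(\<gg>, N)\<close> explicit. If
  \<open>(\<beta>, \<alpha>) = \<tau>(\<gamma>)\<close>, then transporting \<open>s\<close> along \<open>\<gamma>\<close> gives the section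
  \<open>t = \<gamma> \<circ> s \<circ> \<alpha>\<^sup>-\<^sup>1\<close>, whose cocycle is the twisted one because \<open>\<gamma>\<close> preserves all the structure
  (\<open>twist_tau\<close>). Conversely, a section \<open>t\<close> whose cocycle is the twisted one yields a lift
  \<open>\<gamma> (s x + i h) = t (\<alpha> x) + i (\<beta> h)\<close> (\<open>lift_pair\<close>): in the coordinates given by a
  section, the bracket and the Nijenhuis operator of \<open>\<ee>\<close> are determined by those of
  \<open>\<hh>\<close> and \<open>\<gg>\<close> together with the cocycle (\<open>lie_coordinates\<close>, \<open>nij_coordinates\<close>), so \<open>\<gamma>\<close> is a
  homomorphism as soon as the two cocycles correspond under \<open>(\<beta>, \<alpha>)\<close>.

  Exactness at \<open>Aut\<^sub>\<hh>(\<ee>, U)\<close> holds by the definition of the kernel. That \<open>\<tau>\<close> is a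
  homomorphism follows from the two relations \<open>\<gamma> \<circ> i = i \<circ> \<beta>\<close> and \<open>p \<circ> \<gamma> = \<alpha> \<circ> p\<close>, which
  determine \<open>(\<beta>, \<alpha>)\<close> from \<open>\<gamma>\<close> without reference to the section (\<open>tau_fst\<close>, \<open>tau_snd\<close>).
  Since \<open>\<tau>\<close> is thus the same for all sections, the section defining the Wells map may
  differ from the one used in \<open>\<tau>\<close>.\<close>

section \<open>Linear maps and Nijenhuis Lie algebras\<close>

lemma linear_map_iff:
  "linear_map L M f \<longleftrightarrow> Vector_Spaces.vector_space (scl L) \<and> Vector_Spaces.vector_space (scl M) \<and>
    (\<forall>x y. f (x + y) = f x + f y) \<and> (\<forall>c x. f (scl L c x) = scl M c (f x))"
  by (rule Vector_Spaces.linear_iff)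

lemma linear_map_simps:
  assumes "linear_map L M f"
  shows "f (x + y) = f x + f y" "f (x - y) = f x - f y" "f (- x) = - f x" "f 0 = 0"
    "f (scl L c x) = scl M c (f x)"
proof -
  interpret Vector_Spaces.linear "scl L" "scl M" f by (rule assms)
  show "f (x + y) = f x + f y" "f (x - y) = f x - f y" "f (- x) = - f x" "f 0 = 0"
    "f (scl L c x) = scl M c (f x)"
    by (simp_all add: add diff neg zero scale)
qed

lemma linear_map_zero_fun:
  assumes "Vector_Spaces.vector_space (scl L)" "Vector_Spaces.vector_space (scl M)"
  shows "linear_map L M (\<lambda>x. 0)"
  using assms by (simp add: linear_map_iff module_iff_vector_space[symmetric] module.scale_zero_right)

lemma linear_map_uminus:
  "linear_map L M f \<Longrightarrow> linear_map L M (\<lambda>x. - f x)"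
  by (simp add: linear_map_iff module_iff_vector_space[symmetric] module.scale_minus_right)

lemma linear_map_add:
  "linear_map L M f \<Longrightarrow> linear_map L M g \<Longrightarrow> linear_map L M (\<lambda>x. f x + g x)"
  by (simp add: linear_map_iff module_iff_vector_space[symmetric] module.scale_right_distrib)

lemma linear_map_diff:
  "linear_map L M f \<Longrightarrow> linear_map L M g \<Longrightarrow> linear_map L M (\<lambda>x. f x - g x)"
  using linear_map_add[of L M f "\<lambda>x. - g x"] linear_map_uminus[of L M g] by simp

lemma linear_map_compose:
  "linear_map L M f \<Longrightarrow> linear_map M K g \<Longrightarrow> linear_map L K (\<lambda>x. g (f x))"
  by (simp add: linear_map_iff)

text \<open>Cancelling an injective linear map on the left preserves linearity; this is how
  maps defined through \<^term>\<open>the_inv i\<close> inherit linearity from \<open>\<ee>\<close>.\<close>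

lemma linear_map_cancel:
  assumes "linear_map M K i" "inj i" "linear_map L K (\<lambda>x. i (f x))"
  shows "linear_map L M f"
  using assms unfolding linear_map_iff inj_def by metis

lemma nij_lie_hom_inv:
  assumes "nij_lie_hom L M f" "bij f"
  shows "nij_lie_hom M L (inv_into UNIV f)"
proof -
  let ?g = "inv_into UNIV f"
  have fg: "f (?g x) = x" for x using assms(2) by (simp add: bij_is_surj surj_f_inv_f)
  have eq: "?g x = y" if "f y = x" for x y
    using that assms(2) by (metis bij_is_inj inv_f_f)
  show ?thesis
    using assms(1) unfolding nij_lie_hom_def linear_map_iff by (auto intro!: eq simp: fg)
qed

lemma nij_lie_hom_comp:
  assumes "nij_lie_hom L M f" "nij_lie_hom M K g"
  shows "nij_lie_hom L K (g \<circ> f)"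
  using assms unfolding nij_lie_hom_def linear_map_iff by auto

lemma nij_lie_hom_simps:
  assumes "nij_lie_hom L M f"
  shows "f (x + y) = f x + f y" "f (x - y) = f x - f y" "f (- x) = - f x" "f 0 = 0"
    "f (scl L c x) = scl M c (f x)" "f (lie L x y) = lie M (f x) (f y)" "f (nij L x) = nij M (f x)"
  using assms linear_map_simps[of L M f] unfolding nij_lie_hom_def by auto

locale nijenhuis =
  fixes L :: "('k::field, 'a::ab_group_add) nij_lie"
  assumes nij_alg: "nijenhuis_lie_algebra L"
begin

lemma vs: "Vector_Spaces.vector_space (scl L)"
  using nij_alg by (simp add: nijenhuis_lie_algebra_def lie_algebra_def)

lemma lie_linear: "linear_map L L (lie L x)" "linear_map L L (\<lambda>x. lie L x y)"
  and lie_self: "lie L x x = 0"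
  and jacobi: "lie L x (lie L y z) + lie L y (lie L z x) + lie L z (lie L x y) = 0"
  and nij_linear: "linear_map L L (nij L)"
  and nij_nij: "lie L (nij L x) (nij L y) =
    nij L (lie L (nij L x) y + lie L x (nij L y) - nij L (lie L x y))"
  using nij_alg
  unfolding nijenhuis_lie_algebra_def nijenhuis_operator_def lie_algebra_def alternating_bilinear_def
  by blast+

lemmas lie_simps [simp] = lie_linear(1)[THEN linear_map_simps(1)] lie_linear(1)[THEN linear_map_simps(2)]
  lie_linear(1)[THEN linear_map_simps(3)] lie_linear(1)[THEN linear_map_simps(4)]
  lie_linear(2)[THEN linear_map_simps(1)] lie_linear(2)[THEN linear_map_simps(2)]
  lie_linear(2)[THEN linear_map_simps(3)] lie_linear(2)[THEN linear_map_simps(4)] lie_self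
  nij_linear[THEN linear_map_simps(1)] nij_linear[THEN linear_map_simps(2)]
  nij_linear[THEN linear_map_simps(3)] nij_linear[THEN linear_map_simps(4)]

lemma lie_skew: "lie L y x = - lie L x y"
proof -
  have "0 = lie L (x + y) (x + y)" by (simp only: lie_self)
  also have "\<dots> = lie L x x + lie L y x + (lie L x y + lie L y y)"
    by (simp only: lie_simps(1,5))
  finally have "lie L x y + lie L y x = 0" by (simp add: add.commute)
  then show ?thesis by (metis add.inverse_unique)
qed

lemma jacobi_derivation: "lie L x (lie L y z) = lie L (lie L x y) z + lie L y (lie L x z)"
proof -
  have "lie L x (lie L y z) - lie L y (lie L x z) - lie L (lie L x y) z = 0"
    using jacobi[of x y z] lie_skew[of x z] lie_skew[of "lie L x y" z] by simp
  then show ?thesis by (simp add: algebra_simps)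
qed

end

section \<open>Non-abelian cocycles\<close>

text \<open>The witnesses are \<open>0\<close>, \<open>- \<phi>\<close> and \<open>\<phi> + \<theta>\<close>. The condition on \<open>\<chi>\<close> is not linear in \<open>\<phi>\<close>: it has the
  term \<open>[\<phi> x, \<phi> y]\<close> and refers to the second action \<open>\<psi>'\<close>. Replacing one action by the other
  by means of the condition on \<open>\<psi>\<close> produces the brackets that repair the quadratic term.\<close>

lemma nab_equiv_equiv:
  assumes "nijenhuis_lie_algebra H" "nijenhuis_lie_algebra G"
  shows "equiv (nab_cocycles G H) (nab_equiv G H)"
proof -
  interpret H: nijenhuis H by unfold_locales (rule assms)
  interpret G: nijenhuis G by unfold_locales (rule assms)
  have psi: "\<psi> x (h + k) = \<psi> x h + \<psi> x k" "\<psi> x (- h) = - \<psi> x h" "\<psi> x 0 = 0"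
    if "(\<chi>, \<psi>, F) \<in> nab_cocycles G H" for \<chi> \<psi> F x h k
  proof -
    have "linear_map H H (\<psi> x)" using that by (simp add: nab_cocycles_def derivation_def)
    then show "\<psi> x (h + k) = \<psi> x h + \<psi> x k" "\<psi> x (- h) = - \<psi> x h" "\<psi> x 0 = 0"
      by (simp_all add: linear_map_simps)
  qed
  show ?thesis
  proof (rule equivI)
    show "nab_equiv G H \<subseteq> nab_cocycles G H \<times> nab_cocycles G H"
      by (auto simp: nab_equiv_def)
    show "refl_on (nab_cocycles G H) (nab_equiv G H)"
    proof (rule refl_onI)
      fix c assume c: "c \<in> nab_cocycles G H"
      obtain \<chi> \<psi> F where "c = (\<chi>, \<psi>, F)" by (cases c)
      then show "(c, c) \<in> nab_equiv G H"
        using c psi[of \<chi> \<psi> F] linear_map_zero_fun[OF G.vs H.vs]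
        by (auto simp: nab_equiv_def intro!: exI[of _ "\<lambda>x. 0"])
    qed
    show "sym (nab_equiv G H)"
    proof (rule symI)
      fix c d assume "(c, d) \<in> nab_equiv G H"
      moreover obtain \<chi> \<psi> F where c: "c = (\<chi>, \<psi>, F)" by (cases c)
      moreover obtain \<chi>' \<psi>' F' where d: "d = (\<chi>', \<psi>', F')" by (cases d)
      ultimately obtain \<phi> where coc: "(\<chi>, \<psi>, F) \<in> nab_cocycles G H" "(\<chi>', \<psi>', F') \<in> nab_cocycles G H"
        and \<phi>: "linear_map G H \<phi>" "\<And>x h. \<psi> x h - \<psi>' x h = lie H (\<phi> x) h"
          "\<And>x y. \<chi> x y - \<chi>' x y =
            \<psi>' x (\<phi> y) - \<psi>' y (\<phi> x) - \<phi> (lie G x y) + lie H (\<phi> x) (\<phi> y)"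
          "\<And>x. F x - F' x = nij H (\<phi> x) - \<phi> (nij G x)"
        by (auto simp: nab_equiv_def)
      have 1: "\<psi>' x h - \<psi> x h = lie H (- \<phi> x) h" for x h
        using \<phi>(2)[of x h] by (simp add: algebra_simps)
      have p: "\<psi> x h = \<psi>' x h + lie H (\<phi> x) h" for x h
        using \<phi>(2)[of x h] by (simp add: algebra_simps)
      have c: "\<chi> x y = \<chi>' x y + (\<psi>' x (\<phi> y) - \<psi>' y (\<phi> x) - \<phi> (lie G x y) + lie H (\<phi> x) (\<phi> y))"
        for x y using \<phi>(3)[of x y] by (simp add: algebra_simps)
      have 2: "\<chi>' x y - \<chi> x y =
        \<psi> x (- \<phi> y) - \<psi> y (- \<phi> x) - (- \<phi> (lie G x y)) + lie H (- \<phi> x) (- \<phi> y)" for x y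
        using H.lie_skew[of "\<phi> y" "\<phi> x"] by (simp add: psi[OF coc(1)] psi[OF coc(2)] p c)
      have 3: "F' x - F x = nij H (- \<phi> x) - (- \<phi> (nij G x))" for x
        using \<phi>(4)[of x] by (simp add: algebra_simps)
      show "(d, c) \<in> nab_equiv G H"
        unfolding nab_equiv_def \<open>c = (\<chi>, \<psi>, F)\<close> d
        using coc linear_map_uminus[OF \<phi>(1)] 1 2 3
        by (auto intro!: exI[of _ "\<lambda>x. - \<phi> x"])
    qed
    show "trans (nab_equiv G H)"
    proof (rule transI)
      fix c d e assume "(c, d) \<in> nab_equiv G H" "(d, e) \<in> nab_equiv G H"
      moreover obtain \<chi> \<psi> F where c: "c = (\<chi>, \<psi>, F)" by (cases c)
      moreover obtain \<chi>' \<psi>' F' where d: "d = (\<chi>', \<psi>', F')" by (cases d)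
      moreover obtain \<chi>'' \<psi>'' F'' where e: "e = (\<chi>'', \<psi>'', F'')" by (cases e)
      ultimately obtain \<phi> \<theta> where coc: "(\<chi>, \<psi>, F) \<in> nab_cocycles G H"
          "(\<chi>', \<psi>', F') \<in> nab_cocycles G H" "(\<chi>'', \<psi>'', F'') \<in> nab_cocycles G H"
        and \<phi>: "linear_map G H \<phi>" "\<And>x h. \<psi> x h - \<psi>' x h = lie H (\<phi> x) h"
          "\<And>x y. \<chi> x y - \<chi>' x y =
            \<psi>' x (\<phi> y) - \<psi>' y (\<phi> x) - \<phi> (lie G x y) + lie H (\<phi> x) (\<phi> y)"
          "\<And>x. F x - F' x = nij H (\<phi> x) - \<phi> (nij G x)"
        and \<theta>: "linear_map G H \<theta>" "\<And>x h. \<psi>' x h - \<psi>'' x h = lie H (\<theta> x) h"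
          "\<And>x y. \<chi>' x y - \<chi>'' x y =
            \<psi>'' x (\<theta> y) - \<psi>'' y (\<theta> x) - \<theta> (lie G x y) + lie H (\<theta> x) (\<theta> y)"
          "\<And>x. F' x - F'' x = nij H (\<theta> x) - \<theta> (nij G x)"
        by (auto simp: nab_equiv_def)
      have p: "\<psi> x h = \<psi>' x h + lie H (\<phi> x) h" for x h
        using \<phi>(2)[of x h] by (simp add: algebra_simps)
      have p': "\<psi>' x h = \<psi>'' x h + lie H (\<theta> x) h" for x h
        using \<theta>(2)[of x h] by (simp add: algebra_simps)
      have 1: "\<psi> x h - \<psi>'' x h = lie H (\<phi> x + \<theta> x) h" for x h
        by (simp add: p p')
      have c: "\<chi> x y = \<chi>' x y + (\<psi>' x (\<phi> y) - \<psi>' y (\<phi> x) - \<phi> (lie G x y) + lie H (\<phi> x) (\<phi> y))"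
        for x y using \<phi>(3)[of x y] by (simp add: algebra_simps)
      have c': "\<chi>' x y = \<chi>'' x y + (\<psi>'' x (\<theta> y) - \<psi>'' y (\<theta> x) - \<theta> (lie G x y) + lie H (\<theta> x) (\<theta> y))"
        for x y using \<theta>(3)[of x y] by (simp add: algebra_simps)
      have 2: "\<chi> x y - \<chi>'' x y = \<psi>'' x (\<phi> y + \<theta> y) - \<psi>'' y (\<phi> x + \<theta> x)
          - (\<phi> (lie G x y) + \<theta> (lie G x y)) + lie H (\<phi> x + \<theta> x) (\<phi> y + \<theta> y)" for x y
        using H.lie_skew[of "\<theta> y" "\<phi> x"] by (simp add: psi[OF coc(3)] p' c c')
      have f: "F x = F' x + (nij H (\<phi> x) - \<phi> (nij G x))" for x
        using \<phi>(4)[of x] by (simp add: algebra_simps)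
      have f': "F' x = F'' x + (nij H (\<theta> x) - \<theta> (nij G x))" for x
        using \<theta>(4)[of x] by (simp add: algebra_simps)
      have 3: "F x - F'' x = nij H (\<phi> x + \<theta> x) - (\<phi> (nij G x) + \<theta> (nij G x))" for x
        by (simp add: f f')
      show "(c, e) \<in> nab_equiv G H"
        unfolding nab_equiv_def \<open>c = (\<chi>, \<psi>, F)\<close> e
        using coc linear_map_add[OF \<phi>(1) \<theta>(1)] 1 2 3
        by (auto intro!: exI[of _ "\<lambda>x. \<phi> x + \<theta> x"])
    qed
  qed
qed

text \<open>Twisting is transport of structure along the automorphisms \<open>\<beta>\<close> and \<open>\<alpha>\<close>: each cocycle condition
  for the twisted triple is \<open>\<beta>\<close> applied to the original condition at the arguments moved back by
  \<open>\<alpha>\<^sup>-\<^sup>1\<close> and \<open>\<beta>\<^sup>-\<^sup>1\<close>.\<close>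

lemma twist_cocycle:
  assumes \<beta>: "nij_lie_hom H H \<beta>" "bij \<beta>" and \<alpha>: "nij_lie_hom G G \<alpha>" "bij \<alpha>"
    and c: "c \<in> nab_cocycles G H"
  shows "twist (\<beta>, \<alpha>) c \<in> nab_cocycles G H"
proof -
  define a where "a = inv_into UNIV \<alpha>"
  define b where "b = inv_into UNIV \<beta>"
  obtain \<chi> \<psi> F where ceq: "c = (\<chi>, \<psi>, F)" by (cases c)
  have a: "nij_lie_hom G G a" and b: "nij_lie_hom H H b"
    unfolding a_def b_def by (rule nij_lie_hom_inv[OF \<alpha>] nij_lie_hom_inv[OF \<beta>])+
  have bb: "b (\<beta> h) = h" for h unfolding b_def using \<beta>(2) by (simp add: bij_is_inj)
  note \<beta>s = nij_lie_hom_simps[OF \<beta>(1)] and as = nij_lie_hom_simps[OF a] and bs = nij_lie_hom_simps[OF b]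
  have bb': "\<beta> (b h) = h" for h unfolding b_def using \<beta>(2) by (simp add: bij_is_surj surj_f_inv_f)
  have lin: "linear_map G G a" "linear_map H H b" "linear_map H H \<beta>"
    using a b \<beta> by (simp_all add: nij_lie_hom_def)
  have \<chi>: "\<And>x. linear_map G H (\<chi> x)" "\<And>y. linear_map G H (\<lambda>x. \<chi> x y)" "\<And>x. \<chi> x x = 0"
    and \<psi>: "\<And>x. linear_map H H (\<psi> x)"
      "\<And>x h k. \<psi> x (lie H h k) = lie H (\<psi> x h) k + lie H h (\<psi> x k)"
      "\<And>h. linear_map G H (\<lambda>x. \<psi> x h)"
    and F: "linear_map G H F"
    and c1: "\<And>x y h. \<psi> x (\<psi> y h) - \<psi> y (\<psi> x h) - \<psi> (lie G x y) h = lie H (\<chi> x y) h"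
    and c2: "\<And>x y z. \<psi> x (\<chi> y z) + \<psi> y (\<chi> z x) + \<psi> z (\<chi> x y)
      - \<chi> (lie G x y) z - \<chi> (lie G y z) x - \<chi> (lie G z x) y = 0"
    and c3: "\<And>x h. \<psi> (nij G x) (nij H h) =
      nij H (\<psi> (nij G x) h + \<psi> x (nij H h) - nij H (\<psi> x h))
      + nij H (lie H (F x) h) - lie H (F x) (nij H h)"
    and c4: "\<And>x y. \<chi> (nij G x) (nij G y)
      - nij H (\<chi> (nij G x) y + \<chi> x (nij G y) - nij H (\<chi> x y))
      - F (lie G (nij G x) y + lie G x (nij G y) - nij G (lie G x y))
      + \<psi> (nij G x) (F y) - \<psi> (nij G y) (F x)
      - nij H (\<psi> x (F y) - \<psi> y (F x) - F (lie G x y))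
      + lie H (F x) (F y) = 0"
    using c unfolding ceq nab_cocycles_def alternating_bilinear_def derivation_def by auto
  have tw: "twist (\<beta>, \<alpha>) c =
    (\<lambda>x y. \<beta> (\<chi> (a x) (a y)), \<lambda>x h. \<beta> (\<psi> (a x) (b h)), \<lambda>x. \<beta> (F (a x)))"
    by (simp add: twist_def ceq a_def b_def)
  have l\<chi>: "alternating_bilinear G H (\<lambda>x y. \<beta> (\<chi> (a x) (a y)))"
    unfolding alternating_bilinear_def
  proof (intro conjI allI)
    show "linear_map G H (\<lambda>y. \<beta> (\<chi> (a x) (a y)))" for x
      by (rule linear_map_compose[OF linear_map_compose[OF lin(1) \<chi>(1)] lin(3)])
    show "linear_map G H (\<lambda>x. \<beta> (\<chi> (a x) (a y)))" for y
      by (rule linear_map_compose[OF linear_map_compose[OF lin(1) \<chi>(2)] lin(3)])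
    show "\<beta> (\<chi> (a x) (a x)) = 0" for x by (simp add: \<chi> \<beta>s)
  qed
  have der: "derivation H (\<lambda>h. \<beta> (\<psi> (a x) (b h)))" for x
    unfolding derivation_def
    using linear_map_compose[OF linear_map_compose[OF lin(2) \<psi>(1)] lin(3)]
    by (auto simp: bs \<psi>(2) \<beta>s bb')
  have l\<psi>: "linear_map G H (\<lambda>x. \<beta> (\<psi> (a x) (b h)))" for h
    by (rule linear_map_compose[OF linear_map_compose[OF lin(1) \<psi>(3)] lin(3)])
  have lF: "linear_map G H (\<lambda>x. \<beta> (F (a x)))"
    by (rule linear_map_compose[OF linear_map_compose[OF lin(1) F] lin(3)])
  show ?thesis
    unfolding tw nab_cocycles_def mem_Collect_eq prod.case
  proof (intro conjI allI l\<chi> der l\<psi> lF)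
    fix x y z h
    show "\<beta> (\<psi> (a x) (b (\<beta> (\<psi> (a y) (b h))))) - \<beta> (\<psi> (a y) (b (\<beta> (\<psi> (a x) (b h)))))
        - \<beta> (\<psi> (a (lie G x y)) (b h)) = lie H (\<beta> (\<chi> (a x) (a y))) h"
      using arg_cong[OF c1[of "a x" "a y" "b h"], of \<beta>] by (simp add: bb bb' as \<beta>s)
    show "\<beta> (\<psi> (a x) (b (\<beta> (\<chi> (a y) (a z))))) + \<beta> (\<psi> (a y) (b (\<beta> (\<chi> (a z) (a x)))))
       + \<beta> (\<psi> (a z) (b (\<beta> (\<chi> (a x) (a y)))))
       - \<beta> (\<chi> (a (lie G x y)) (a z)) - \<beta> (\<chi> (a (lie G y z)) (a x)) - \<beta> (\<chi> (a (lie G z x)) (a y)) = 0"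
      using arg_cong[OF c2[of "a x" "a y" "a z"], of \<beta>] by (simp add: bb bb' as \<beta>s)
    show "\<beta> (\<psi> (a (nij G x)) (b (nij H h))) =
      nij H (\<beta> (\<psi> (a (nij G x)) (b h)) + \<beta> (\<psi> (a x) (b (nij H h))) - nij H (\<beta> (\<psi> (a x) (b h))))
      + nij H (lie H (\<beta> (F (a x))) h) - lie H (\<beta> (F (a x))) (nij H h)"
      using arg_cong[OF c3[of "a x" "b h"], of \<beta>] by (simp add: bb bb' as bs \<beta>s)
    show "\<beta> (\<chi> (a (nij G x)) (a (nij G y)))
      - nij H (\<beta> (\<chi> (a (nij G x)) (a y)) + \<beta> (\<chi> (a x) (a (nij G y))) - nij H (\<beta> (\<chi> (a x) (a y))))
      - \<beta> (F (a (lie G (nij G x) y + lie G x (nij G y) - nij G (lie G x y))))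
      + \<beta> (\<psi> (a (nij G x)) (b (\<beta> (F (a y))))) - \<beta> (\<psi> (a (nij G y)) (b (\<beta> (F (a x)))))
      - nij H (\<beta> (\<psi> (a x) (b (\<beta> (F (a y))))) - \<beta> (\<psi> (a y) (b (\<beta> (F (a x)))))
          - \<beta> (F (a (lie G x y))))
      + lie H (\<beta> (F (a x))) (\<beta> (F (a y))) = 0"
      using arg_cong[OF c4[of "a x" "a y"], of \<beta>] by (simp add: bb bb' as \<beta>s)
  qed
qed

section \<open>Sections of an extension and their cocycles\<close>

locale extension =
  fixes H :: "('k::field, 'h::ab_group_add) nij_lie"
    and E :: "('k, 'e::ab_group_add) nij_lie"
    and G :: "('k, 'g::ab_group_add) nij_lie"
    and i :: "'h \<Rightarrow> 'e" and p :: "'e \<Rightarrow> 'g"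
  assumes ext: "nij_extension H E G i p"
begin

sublocale H: nijenhuis H using ext by unfold_locales (simp add: nij_extension_def)
sublocale E: nijenhuis E using ext by unfold_locales (simp add: nij_extension_def)
sublocale G: nijenhuis G using ext by unfold_locales (simp add: nij_extension_def)

lemma i_hom: "nij_lie_hom H E i" and p_hom: "nij_lie_hom E G p"
  and inj_i: "inj i" and surj_p: "surj p" and range_i: "range i = {e. p e = 0}"
  using ext by (simp_all add: nij_extension_def)

lemmas i_simps [simp] = nij_lie_hom_simps[OF i_hom]
lemmas p_simps [simp] = nij_lie_hom_simps[OF p_hom]

lemma i_linear: "linear_map H E i" and p_linear: "linear_map E G p"
  using i_hom p_hom by (simp_all add: nij_lie_hom_def)

lemma p_i [simp]: "p (i h) = 0"
  using range_i by auto

lemma i_the_inv: "p e = 0 \<Longrightarrow> i (the_inv i e) = e"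
  using range_i inj_i by (simp add: f_the_inv_into_f)

lemma the_inv_i [simp]: "the_inv i (i h) = h"
  using inj_i by (rule the_inv_f_f)

lemma i_eq_iff: "i h = i k \<longleftrightarrow> h = k"
  using inj_i by (simp add: inj_eq)

lemma section_exists: "\<exists>s. section_of E G p s"
proof -
  interpret vector_space_pair "scl E" "scl G"
    using E.vs G.vs by (simp add: vector_space_pair_def)
  show ?thesis
    unfolding section_of_def using linear_surjective_right_inverse[OF p_linear surj_p] .
qed

end

locale split_extension = extension H E G i p
  for H :: "('k::field, 'h::ab_group_add) nij_lie"
    and E :: "('k, 'e::ab_group_add) nij_lie"
    and G :: "('k, 'g::ab_group_add) nij_lie"
    and i :: "'h \<Rightarrow> 'e" and p :: "'e \<Rightarrow> 'g" +
  fixes s :: "'g \<Rightarrow> 'e"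
  assumes sec: "section_of E G p s"
begin

definition "chi x y = the_inv i (lie E (s x) (s y) - s (lie G x y))"
definition "psi x h = the_inv i (lie E (s x) (i h))"
definition "eff x = the_inv i (nij E (s x) - s (nij G x))"

lemma ext_cocycle_eq: "ext_cocycle E G i s = (chi, psi, eff)"
  by (simp add: ext_cocycle_def chi_def[abs_def] psi_def[abs_def] eff_def[abs_def])

lemma s_linear: "linear_map G E s" and p_s [simp]: "p (s x) = x"
  using sec by (simp_all add: section_of_def fun_eq_iff)

lemmas s_simps = linear_map_simps[OF s_linear]

lemma i_chi: "i (chi x y) = lie E (s x) (s y) - s (lie G x y)"
  and i_psi: "i (psi x h) = lie E (s x) (i h)"
  and i_eff: "i (eff x) = nij E (s x) - s (nij G x)"
  unfolding chi_def psi_def eff_def by (simp_all add: i_the_inv)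

lemma decompose: obtains x h where "e = s x + i h"
  using i_the_inv[of "e - s (p e)"] that[of "p e" "the_inv i (e - s (p e))"] by simp

lemma coordinates_eq_iff: "s x + i h = s y + i k \<longleftrightarrow> x = y \<and> h = k"
proof
  assume eq: "s x + i h = s y + i k"
  from arg_cong[OF eq, of p] have "x = y" by simp
  with eq show "x = y \<and> h = k" by (simp add: i_eq_iff)
qed simp

text \<open>A section identifies \<open>\<ee>\<close> with \<open>\<gg> \<oplus> \<hh>\<close>. The next two formulas show that in these coordinates the
  cocycle carries all the information on \<open>\<ee>\<close> not already contained in \<open>\<gg>\<close> and \<open>\<hh>\<close>.\<close>

lemma lie_coordinates:
  "lie E (s x + i h) (s y + i k) = s (lie G x y) + i (chi x y + psi x k - psi y h + lie H h k)"
  using E.lie_skew[of "s y" "i h"] by (simp add: i_chi i_psi)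

lemma nij_coordinates: "nij E (s x + i h) = s (nij G x) + i (eff x + nij H h)"
  by (simp add: i_eff)

text \<open>After applying the injective map \<open>i\<close>, the cocycle conditions become identities in \<open>\<ee>\<close>: the
  derivation property and the first condition are Jacobi identities with one or two arguments in
  the image of \<open>s\<close>, the second is the Jacobi identity for three such arguments, and the last two are
  the Nijenhuis identity on pairs \<open>(s x, i h)\<close> and \<open>(s x, s y)\<close>.\<close>

lemma ext_cocycle_cocycle: "ext_cocycle E G i s \<in> nab_cocycles G H"
proof -
  note li = linear_map_cancel[OF i_linear inj_i]
  have lchi: "alternating_bilinear G H chi"
    unfolding alternating_bilinear_def
  proof (intro conjI allI)
    show "linear_map G H (chi x)" for x
      by (rule li, unfold i_chi, intro linear_map_diff linear_map_compose[OF s_linear]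
          linear_map_compose[OF _ s_linear] E.lie_linear G.lie_linear)
    show "linear_map G H (\<lambda>x. chi x y)" for y
      by (rule li, unfold i_chi, intro linear_map_diff linear_map_compose[OF s_linear]
          linear_map_compose[OF _ s_linear] E.lie_linear G.lie_linear)
    show "chi x x = 0" for x
      by (subst i_eq_iff[symmetric]) (simp add: i_chi s_simps)
  qed
  have der: "derivation H (psi x)" for x
    unfolding derivation_def
  proof (intro conjI allI)
    show "linear_map H H (psi x)"
      by (rule li, unfold i_psi, rule linear_map_compose[OF i_linear E.lie_linear(1)])
    show "psi x (lie H h k) = lie H (psi x h) k + lie H h (psi x k)" for h k
      by (subst i_eq_iff[symmetric]) (simp add: i_psi E.jacobi_derivation[of "s x"])
  qed
  have lpsi: "linear_map G H (\<lambda>x. psi x h)" for h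
    by (rule li, unfold i_psi, rule linear_map_compose[OF s_linear E.lie_linear(2)])
  have leff: "linear_map G H eff"
    by (rule li, unfold i_eff, intro linear_map_diff linear_map_compose[OF s_linear]
          linear_map_compose[OF _ s_linear] E.nij_linear G.nij_linear)
  show ?thesis
    unfolding ext_cocycle_eq nab_cocycles_def mem_Collect_eq prod.case
  proof (intro conjI allI lchi der lpsi leff; subst i_eq_iff[symmetric])
    fix x y z h
    show "i (psi x (psi y h) - psi y (psi x h) - psi (lie G x y) h) = i (lie H (chi x y) h)"
      using E.jacobi_derivation[of "s x" "s y" "i h"] by (simp add: i_psi i_chi)
    have "lie G (lie G x y) z + lie G (lie G y z) x + lie G (lie G z x) y =
        - (lie G x (lie G y z) + lie G y (lie G z x) + lie G z (lie G x y))"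
      by (simp add: G.lie_skew[of z "lie G x y"] G.lie_skew[of x "lie G y z"]
          G.lie_skew[of y "lie G z x"])
    then have sj: "s (lie G (lie G x y) z) + s (lie G (lie G y z) x) + s (lie G (lie G z x) y) = 0"
      unfolding G.jacobi by (simp flip: s_simps)
    show "i (psi x (chi y z) + psi y (chi z x) + psi z (chi x y)
        - chi (lie G x y) z - chi (lie G y z) x - chi (lie G z x) y) = i 0"
      using E.jacobi[of "s x" "s y" "s z"] sj
        E.lie_skew[of "s (lie G x y)" "s z"] E.lie_skew[of "s (lie G y z)" "s x"]
        E.lie_skew[of "s (lie G z x)" "s y"]
      by (simp add: i_psi i_chi algebra_simps)
    show "i (psi (nij G x) (nij H h)) =
        i (nij H (psi (nij G x) h + psi x (nij H h) - nij H (psi x h))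
        + nij H (lie H (eff x) h) - lie H (eff x) (nij H h))"
      using E.nij_nij[of "s x" "i h"] by (simp add: i_psi i_eff)
    show "i (chi (nij G x) (nij G y)
      - nij H (chi (nij G x) y + chi x (nij G y) - nij H (chi x y))
      - eff (lie G (nij G x) y + lie G x (nij G y) - nij G (lie G x y))
      + psi (nij G x) (eff y) - psi (nij G y) (eff x)
      - nij H (psi x (eff y) - psi y (eff x) - eff (lie G x y))
      + lie H (eff x) (eff y)) = i 0"
      using E.nij_nij[of "s x" "s y"] G.nij_nij[of x y]
        E.lie_skew[of "s (nij G y)" "s (nij G x)"] E.lie_skew[of "s y" "s (nij G x)"]
        E.lie_skew[of "s (nij G y)" "nij E (s x)"] E.lie_skew[of "s y" "nij E (s x)"]
      by (simp add: i_psi i_chi i_eff s_simps)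
  qed
qed

lemma section_shift:
  assumes "linear_map G H \<phi>"
  shows "section_of E G p (\<lambda>x. s x + i (\<phi> x))"
  using linear_map_add[OF s_linear linear_map_compose[OF assms i_linear]]
  by (simp add: section_of_def fun_eq_iff)

lemma ext_cocycle_shift:
  assumes "linear_map G H \<phi>"
  shows "ext_cocycle E G i (\<lambda>x. s x + i (\<phi> x)) =
    (\<lambda>x y. chi x y + psi x (\<phi> y) - psi y (\<phi> x) - \<phi> (lie G x y) + lie H (\<phi> x) (\<phi> y),
     \<lambda>x h. psi x h + lie H (\<phi> x) h,
     \<lambda>x. eff x + nij H (\<phi> x) - \<phi> (nij G x))"
proof -
  interpret t: split_extension H E G i p "\<lambda>x. s x + i (\<phi> x)"
    by unfold_locales (rule section_shift[OF assms])
  have "t.chi x y = chi x y + psi x (\<phi> y) - psi y (\<phi> x) - \<phi> (lie G x y) + lie H (\<phi> x) (\<phi> y)" for x y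
    by (subst i_eq_iff[symmetric], unfold t.i_chi lie_coordinates) simp
  moreover have "t.psi x h = psi x h + lie H (\<phi> x) h" for x h
    by (subst i_eq_iff[symmetric], unfold t.i_psi) (simp add: i_psi)
  moreover have "t.eff x = eff x + nij H (\<phi> x) - \<phi> (nij G x)" for x
    by (subst i_eq_iff[symmetric], unfold t.i_eff nij_coordinates) simp
  ultimately show ?thesis by (simp add: t.ext_cocycle_eq fun_eq_iff)
qed

text \<open>Every equivalence \<open>\<phi>\<close> is realised by the change of section \<open>s \<mapsto> s + i \<circ> \<phi>\<close>, and every change of
  section has this form, because the difference of two sections takes values in the kernel of \<open>p\<close>.\<close>

lemma equivalent_cocycle_iff:
  "(c, ext_cocycle E G i s) \<in> nab_equiv G H \<longleftrightarrow> (\<exists>t. section_of E G p t \<and> c = ext_cocycle E G i t)"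
proof
  assume "(c, ext_cocycle E G i s) \<in> nab_equiv G H"
  moreover obtain \<chi> \<psi> F where c: "c = (\<chi>, \<psi>, F)" by (cases c)
  ultimately obtain \<phi> where \<phi>: "linear_map G H \<phi>" "\<And>x h. \<psi> x h - psi x h = lie H (\<phi> x) h"
      "\<And>x y. \<chi> x y - chi x y = psi x (\<phi> y) - psi y (\<phi> x) - \<phi> (lie G x y) + lie H (\<phi> x) (\<phi> y)"
      "\<And>x. F x - eff x = nij H (\<phi> x) - \<phi> (nij G x)"
    by (auto simp: nab_equiv_def ext_cocycle_eq)
  have "\<psi> x h = psi x h + lie H (\<phi> x) h" for x h
    using \<phi>(2)[of x h] by (simp add: algebra_simps)
  moreover have "\<chi> x y = chi x y + psi x (\<phi> y) - psi y (\<phi> x) - \<phi> (lie G x y) + lie H (\<phi> x) (\<phi> y)" for x y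
    using \<phi>(3)[of x y] by (simp add: algebra_simps)
  moreover have "F x = eff x + nij H (\<phi> x) - \<phi> (nij G x)" for x
    using \<phi>(4)[of x] by (simp add: algebra_simps)
  ultimately have "c = ext_cocycle E G i (\<lambda>x. s x + i (\<phi> x))"
    unfolding c ext_cocycle_shift[OF \<phi>(1)] by (simp add: fun_eq_iff)
  then show "\<exists>t. section_of E G p t \<and> c = ext_cocycle E G i t"
    using section_shift[OF \<phi>(1)] by blast
next
  assume "\<exists>t. section_of E G p t \<and> c = ext_cocycle E G i t"
  then obtain t where t: "section_of E G p t" "c = ext_cocycle E G i t" by blast
  interpret t: split_extension H E G i p t by unfold_locales (rule t)
  define \<phi> where "\<phi> x = the_inv i (t x - s x)" for x
  have i\<phi>: "i (\<phi> x) = t x - s x" for x unfolding \<phi>_def by (simp add: i_the_inv)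
  have \<phi>: "linear_map G H \<phi>"
    by (rule linear_map_cancel[OF i_linear inj_i], unfold i\<phi>)
      (rule linear_map_diff[OF t.s_linear s_linear])
  have "(\<lambda>x. s x + i (\<phi> x)) = t" by (simp add: i\<phi>)
  then have c: "c = ext_cocycle E G i (\<lambda>x. s x + i (\<phi> x))" using t(2) by simp
  show "(c, ext_cocycle E G i s) \<in> nab_equiv G H"
    using t.ext_cocycle_cocycle ext_cocycle_cocycle \<phi>
    unfolding t(2)[symmetric] unfolding c ext_cocycle_shift[OF \<phi>] ext_cocycle_eq nab_equiv_def
    by (auto intro!: exI[of _ \<phi>])
qed

end

section \<open>Automorphism groups and the map \<open>\<tau>\<close>\<close>

lemma composition_monoid_simps [simp]:
  "carrier (composition_monoid A) = A" "f \<otimes>\<^bsub>composition_monoid A\<^esub> g = f \<circ> g"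
  "\<one>\<^bsub>composition_monoid A\<^esub> = id"
  by (simp_all add: composition_monoid_def)

lemma composition_monoid_group:
  assumes "id \<in> A" "\<And>f g. f \<in> A \<Longrightarrow> g \<in> A \<Longrightarrow> f \<circ> g \<in> A"
    "\<And>f. f \<in> A \<Longrightarrow> bij f \<and> inv_into UNIV f \<in> A"
  shows "group (composition_monoid A)"
proof (rule groupI)
  fix f assume "f \<in> carrier (composition_monoid A)"
  then have "inv_into UNIV f \<in> A" "inv_into UNIV f \<circ> f = id"
    using assms(3)[of f] by (auto simp: bij_is_inj)
  then show "\<exists>g\<in>carrier (composition_monoid A).
      g \<otimes>\<^bsub>composition_monoid A\<^esub> f = \<one>\<^bsub>composition_monoid A\<^esub>"
    by auto
qed (use assms in \<open>auto simp: comp_assoc\<close>)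

lemma carrier_Aut [simp]: "carrier (Aut L) = {\<gamma>. nij_lie_hom L L \<gamma> \<and> bij \<gamma>}"
  by (simp add: Aut_def)

lemma mult_Aut [simp]: "f \<otimes>\<^bsub>Aut L\<^esub> g = f \<circ> g" and one_Aut [simp]: "\<one>\<^bsub>Aut L\<^esub> = id"
  by (simp_all add: Aut_def)

context nijenhuis
begin

lemma id_hom: "nij_lie_hom L L id"
  using vs by (simp add: nij_lie_hom_def linear_map_iff)

lemma Aut_group: "group (Aut L)"
  unfolding Aut_def
  by (rule composition_monoid_group)
    (auto simp: id_hom nij_lie_hom_comp nij_lie_hom_inv bij_comp bij_imp_bij_inv)

end

context extension
begin

lemma carrier_Aut_h:
  "carrier (Aut_h E i) = {\<gamma>. nij_lie_hom E E \<gamma> \<and> bij \<gamma> \<and> \<gamma> ` range i = range i}"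
  by (simp add: Aut_h_def)

lemma mult_Aut_h [simp]: "f \<otimes>\<^bsub>Aut_h E i\<^esub> g = f \<circ> g"
  by (simp add: Aut_h_def)

lemma Aut_h_group: "group (Aut_h E i)"
proof -
  have inv: "inv_into UNIV \<gamma> ` range i = range i" if "bij \<gamma>" "\<gamma> ` range i = range i" for \<gamma>
    using that by (metis bij_is_inj image_inv_f_f)
  have comp: "(\<gamma> \<circ> \<delta>) ` range i = range i" if "\<gamma> ` range i = range i" "\<delta> ` range i = range i" for \<gamma> \<delta>
    using that by (metis image_comp)
  show ?thesis
    unfolding Aut_h_def
    by (rule composition_monoid_group)
      (use inv comp in \<open>auto simp only: carrier_Aut mem_Collect_eq E.id_hom nij_lie_hom_comp
         nij_lie_hom_inv bij_comp bij_id bij_imp_bij_inv image_id id_apply\<close>)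
qed

end

context split_extension
begin

text \<open>The relations \<open>i \<circ> \<beta> = \<gamma> \<circ> i\<close> and \<open>\<alpha> \<circ> p = p \<circ> \<gamma>\<close> characterise \<open>(\<beta>, \<alpha>) = \<tau>(\<gamma>)\<close>; all properties
  of \<open>\<tau>\<close> are derived from them instead of its definition by \<open>i\<^sup>-\<^sup>1\<close> and \<open>s\<close>. The second holds because
  \<open>e\<close> and \<open>s (p e)\<close> differ by an element of \<open>range i\<close>, which \<open>\<gamma>\<close> maps into the kernel of \<open>p\<close>.\<close>

lemma tau_fst:
  assumes "\<gamma> \<in> carrier (Aut_h E i)"
  shows "i (fst (tau i p s \<gamma>) h) = \<gamma> (i h)"
proof -
  have "\<gamma> (i h) \<in> range i" using assms by (auto simp: carrier_Aut_h)
  then have "p (\<gamma> (i h)) = 0" using range_i by auto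
  then show ?thesis by (simp add: tau_def i_the_inv)
qed

lemma tau_snd:
  assumes "\<gamma> \<in> carrier (Aut_h E i)"
  shows "snd (tau i p s \<gamma>) (p e) = p (\<gamma> e)"
proof -
  obtain x h where e: "e = s x + i h" by (rule decompose)
  have "p (\<gamma> (i h)) = 0" using tau_fst[OF assms, of h] p_i by metis
  moreover have "nij_lie_hom E E \<gamma>" using assms by (simp add: carrier_Aut_h)
  ultimately show ?thesis by (simp add: e tau_def nij_lie_hom_simps)
qed

lemma tau_eqI:
  assumes "\<gamma> \<in> carrier (Aut_h E i)"
    and "\<And>h. \<gamma> (i h) = i (\<beta> h)" "\<And>e. p (\<gamma> e) = \<alpha> (p e)"
  shows "tau i p s \<gamma> = (\<beta>, \<alpha>)"
  using assms by (simp add: tau_def fun_eq_iff)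

text \<open>Bijectivity of both components uses the equality \<open>\<gamma> (\<hh>) = \<hh>\<close>; with the inclusion \<open>\<gamma> (\<hh>) \<subseteq> \<hh>\<close>
  alone, the restriction could fail to be surjective and the induced map to be injective.\<close>

lemma tau_Aut:
  assumes \<gamma>: "\<gamma> \<in> carrier (Aut_h E i)"
  shows "tau i p s \<gamma> \<in> carrier (Aut H \<times>\<times> Aut G)"
proof -
  define \<beta> where "\<beta> = fst (tau i p s \<gamma>)"
  define \<alpha> where "\<alpha> = snd (tau i p s \<gamma>)"
  have hom: "nij_lie_hom E E \<gamma>" and bij: "bij \<gamma>" and ran: "\<gamma> ` range i = range i"
    using \<gamma> by (simp_all add: carrier_Aut_h)
  have lin: "linear_map E E \<gamma>" using hom by (simp add: nij_lie_hom_def)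
  note \<gamma>s = nij_lie_hom_simps[OF hom]
  have i\<beta>: "i (\<beta> h) = \<gamma> (i h)" for h unfolding \<beta>_def by (rule tau_fst[OF \<gamma>])
  have \<alpha>p: "\<alpha> (p e) = p (\<gamma> e)" for e unfolding \<alpha>_def by (rule tau_snd[OF \<gamma>])
  have \<alpha>: "\<alpha> x = p (\<gamma> (s x))" for x using \<alpha>p[of "s x"] by simp
  have "linear_map H H \<beta>"
    by (rule linear_map_cancel[OF i_linear inj_i], unfold i\<beta>)
      (rule linear_map_compose[OF i_linear lin])
  moreover have "\<beta> (lie H h k) = lie H (\<beta> h) (\<beta> k)" for h k
    by (subst i_eq_iff[symmetric]) (simp add: i\<beta> \<gamma>s)
  moreover have "\<beta> (nij H h) = nij H (\<beta> h)" for h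
    by (subst i_eq_iff[symmetric]) (simp add: i\<beta> \<gamma>s)
  ultimately have \<beta>hom: "nij_lie_hom H H \<beta>" by (simp add: nij_lie_hom_def)
  have "linear_map G G \<alpha>"
    unfolding \<alpha> [abs_def] by (rule linear_map_compose[OF linear_map_compose[OF s_linear lin] p_linear])
  moreover have "\<alpha> (lie G x y) = lie G (\<alpha> x) (\<alpha> y)" for x y
    using \<alpha>p[of "lie E (s x) (s y)"] by (simp add: \<gamma>s \<alpha>)
  moreover have "\<alpha> (nij G x) = nij G (\<alpha> x)" for x
    using \<alpha>p[of "nij E (s x)"] by (simp add: \<gamma>s \<alpha>)
  ultimately have \<alpha>hom: "nij_lie_hom G G \<alpha>" by (simp add: nij_lie_hom_def)
  have "bij \<beta>"
  proof (rule bijI)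
    show "inj \<beta>"
      using i\<beta> bij inj_i unfolding inj_def bij_def by metis
    show "surj \<beta>"
    unfolding surj_def
    proof (rule allI)
      fix h
      have "i h \<in> \<gamma> ` range i" using ran by simp
      then obtain k where "i h = \<gamma> (i k)" by auto
      then have "h = \<beta> k" by (simp add: i\<beta>[symmetric] i_eq_iff)
      then show "\<exists>k. h = \<beta> k" ..
    qed
  qed
  moreover have "bij \<alpha>"
  proof (rule bijI)
    show "inj \<alpha>"
    proof (rule injI)
      fix x y assume "\<alpha> x = \<alpha> y"
      then have "p (\<gamma> (s x - s y)) = 0" by (simp add: \<alpha> \<gamma>s)
      then have "\<gamma> (s x - s y) \<in> \<gamma> ` range i" using ran range_i by simp
      then obtain h where "s x - s y = i h" using bij by (auto simp: bij_is_inj inj_eq)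
      then have "p (s x - s y) = p (i h)" by (rule arg_cong)
      then show "x = y" by simp
    qed
    show "surj \<alpha>"
    unfolding surj_def
    proof (rule allI)
      fix x
      obtain f where "s x = \<gamma> f" using bij by (meson bij_pointE)
      then have "x = \<alpha> (p f)" using \<alpha>p[of f] p_s[of x] by simp
      then show "\<exists>y. x = \<alpha> y" ..
    qed
  qed
  ultimately show ?thesis
    using \<beta>hom \<alpha>hom by (simp add: \<alpha>_def \<beta>_def mem_Times_iff)
qed

lemma tau_group_hom: "group_hom (Aut_h E i) (Aut H \<times>\<times> Aut G) (tau i p s)"
proof -
  have "tau i p s (\<gamma> \<circ> \<delta>) = tau i p s \<gamma> \<otimes>\<^bsub>Aut H \<times>\<times> Aut G\<^esub> tau i p s \<delta>"
    if \<gamma>: "\<gamma> \<in> carrier (Aut_h E i)" and \<delta>: "\<delta> \<in> carrier (Aut_h E i)" for \<gamma> \<delta>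
  proof -
    have "\<gamma> \<circ> \<delta> \<in> carrier (Aut_h E i)"
      using monoid.m_closed[OF group.is_monoid[OF Aut_h_group] \<gamma> \<delta>] by simp
    then have "tau i p s (\<gamma> \<circ> \<delta>) = (fst (tau i p s \<gamma>) \<circ> fst (tau i p s \<delta>),
        snd (tau i p s \<gamma>) \<circ> snd (tau i p s \<delta>))"
      by (rule tau_eqI) (simp_all add: tau_fst tau_snd \<gamma> \<delta>)
    then show ?thesis by (simp add: DirProd_def case_prod_beta)
  qed
  then show ?thesis
    using Aut_h_group DirProd_group[OF H.Aut_group G.Aut_group] tau_Aut
    by (auto simp: group_hom_def group_hom_axioms_def hom_def simp del: carrier_Aut)
qed

lemma carrier_Aut_hg:
  "carrier (Aut_hg E i p s) = kernel (Aut_h E i) (Aut H \<times>\<times> Aut G) (tau i p s)"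
  by (simp add: Aut_hg_def kernel_def)

lemma Aut_hg_inclusion: "group_hom (Aut_hg E i p s) (Aut_h E i) (\<lambda>\<gamma>. \<gamma>)"
proof -
  interpret tau: group_hom "Aut_h E i" "Aut H \<times>\<times> Aut G" "tau i p s" by (rule tau_group_hom)
  have "Aut_hg E i p s = (Aut_h E i)\<lparr>carrier := kernel (Aut_h E i) (Aut H \<times>\<times> Aut G) (tau i p s)\<rparr>"
    by (simp add: Aut_hg_def Aut_h_def composition_monoid_def kernel_def)
  then have "group (Aut_hg E i p s)"
    using subgroup.subgroup_is_group[OF tau.subgroup_kernel Aut_h_group] by simp
  then show ?thesis
    using Aut_h_group
    by (auto simp: group_hom_def group_hom_axioms_def hom_def Aut_hg_def)
qed

section \<open>Inducible pairs\<close>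

lemma tau_independent:
  assumes "\<gamma> \<in> carrier (Aut_h E i)" "section_of E G p t"
  shows "tau i p t \<gamma> = tau i p s \<gamma>"
proof -
  have "p (t x) = x" for x using assms(2) by (simp add: section_of_def fun_eq_iff)
  then have "p (\<gamma> (t x)) = p (\<gamma> (s x))" for x
    using tau_snd[OF assms(1), of "t x"] tau_snd[OF assms(1), of "s x"] by simp
  then show ?thesis by (simp add: tau_def fun_eq_iff)
qed

text \<open>The section is \<open>\<gamma> \<circ> s \<circ> \<alpha>\<^sup>-\<^sup>1\<close>: it measures the same failures to commute with the bracket
  and the Nijenhuis operator as \<open>s\<close>, transported by the automorphism \<open>\<gamma>\<close>.\<close>

lemma twist_tau:
  assumes \<gamma>: "\<gamma> \<in> carrier (Aut_h E i)"
  shows "\<exists>t. section_of E G p t \<and> twist (tau i p s \<gamma>) (ext_cocycle E G i s) = ext_cocycle E G i t"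
proof -
  define \<beta> where "\<beta> = fst (tau i p s \<gamma>)"
  define \<alpha> where "\<alpha> = snd (tau i p s \<gamma>)"
  define a where "a = inv_into UNIV \<alpha>"
  define b where "b = inv_into UNIV \<beta>"
  define t where "t x = \<gamma> (s (a x))" for x
  have \<tau>: "tau i p s \<gamma> = (\<beta>, \<alpha>)" by (simp add: \<alpha>_def \<beta>_def)
  have hom: "nij_lie_hom E E \<gamma>" using \<gamma> by (simp add: carrier_Aut_h)
  note \<gamma>s = nij_lie_hom_simps[OF hom]
  have \<beta>: "bij \<beta>" and \<alpha>: "nij_lie_hom G G \<alpha>" "bij \<alpha>"
    using tau_Aut[OF \<gamma>] by (simp_all add: \<tau>)
  have i\<beta>: "i (\<beta> h) = \<gamma> (i h)" for h unfolding \<beta>_def by (rule tau_fst[OF \<gamma>])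
  have \<alpha>p: "\<alpha> (p e) = p (\<gamma> e)" for e unfolding \<alpha>_def by (rule tau_snd[OF \<gamma>])
  have ahom: "nij_lie_hom G G a" unfolding a_def by (rule nij_lie_hom_inv[OF \<alpha>])
  note as = nij_lie_hom_simps[OF ahom]
  have \<alpha>a: "\<alpha> (a x) = x" for x unfolding a_def using \<alpha>(2) by (simp add: bij_is_surj surj_f_inv_f)
  have \<gamma>b: "\<gamma> (i (b h)) = i h" for h
    unfolding i\<beta>[symmetric] b_def using \<beta> by (simp add: bij_is_surj surj_f_inv_f)
  have "linear_map G E t"
    unfolding t_def using hom ahom
    by (intro linear_map_compose[OF linear_map_compose[OF _ s_linear]]) (simp_all add: nij_lie_hom_def)
  moreover have "p (t x) = x" for x
    using \<alpha>p[of "s (a x)"] by (simp add: t_def \<alpha>a)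
  ultimately have t: "section_of E G p t" by (simp add: section_of_def fun_eq_iff)
  interpret t: split_extension H E G i p t by unfold_locales (rule t)
  have "\<beta> (chi (a x) (a y)) = t.chi x y" for x y
    by (subst i_eq_iff[symmetric]) (simp add: i\<beta> i_chi t.i_chi t_def \<gamma>s as)
  moreover have "\<beta> (psi (a x) (b h)) = t.psi x h" for x h
    by (subst i_eq_iff[symmetric]) (simp add: i\<beta> i_psi t.i_psi t_def \<gamma>s as \<gamma>b)
  moreover have "\<beta> (eff (a x)) = t.eff x" for x
    by (subst i_eq_iff[symmetric]) (simp add: i\<beta> i_eff t.i_eff t_def \<gamma>s as)
  ultimately have "twist (tau i p s \<gamma>) (ext_cocycle E G i s) = ext_cocycle E G i t"
    by (simp add: \<tau> twist_def ext_cocycle_eq t.ext_cocycle_eq a_def b_def)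
  with t show ?thesis by blast
qed

text \<open>The converse of the previous lemma. The lift is forced: an automorphism \<open>\<gamma>\<close> inducing
  \<open>(\<beta>, \<alpha>)\<close> and satisfying \<open>t = \<gamma> \<circ> s \<circ> \<alpha>\<^sup>-\<^sup>1\<close> must send \<open>s x + i h\<close> to
  \<open>t (\<alpha> x) + i (\<beta> h)\<close>. The hypothesis on the cocycles says that their components correspond
  under \<open>(\<beta>, \<alpha>)\<close>, so the coordinate formulas with respect to \<open>s\<close> and \<open>t\<close> match.\<close>

lemma lift_pair:
  assumes \<beta>: "nij_lie_hom H H \<beta>" "bij \<beta>" and \<alpha>: "nij_lie_hom G G \<alpha>" "bij \<alpha>"
    and t: "section_of E G p t"
    and tw: "twist (\<beta>, \<alpha>) (ext_cocycle E G i s) = ext_cocycle E G i t"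
  shows "\<exists>\<gamma> \<in> carrier (Aut_h E i). tau i p s \<gamma> = (\<beta>, \<alpha>)"
proof -
  interpret t: split_extension H E G i p t by unfold_locales (rule t)
  note \<beta>s = nij_lie_hom_simps[OF \<beta>(1)] and \<alpha>s = nij_lie_hom_simps[OF \<alpha>(1)]
  have a\<alpha>: "inv_into UNIV \<alpha> (\<alpha> x) = x" for x using \<alpha>(2) by (simp add: bij_is_inj)
  have b\<beta>: "inv_into UNIV \<beta> (\<beta> h) = h" for h using \<beta>(2) by (simp add: bij_is_inj)
  have tchi: "t.chi (\<alpha> x) (\<alpha> y) = \<beta> (chi x y)" and tpsi: "t.psi (\<alpha> x) (\<beta> h) = \<beta> (psi x h)"
    and teff: "t.eff (\<alpha> x) = \<beta> (eff x)" for x y h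
    using arg_cong[OF tw, of "\<lambda>c. fst c (\<alpha> x) (\<alpha> y)"]
      arg_cong[OF tw, of "\<lambda>c. fst (snd c) (\<alpha> x) (\<beta> h)"]
      arg_cong[OF tw, of "\<lambda>c. snd (snd c) (\<alpha> x)"]
    by (simp_all add: twist_def ext_cocycle_eq t.ext_cocycle_eq a\<alpha> b\<beta>)
  \<comment> \<open>\<open>p e\<close> and \<open>i\<^sup>-\<^sup>1 (e - s (p e))\<close> are the coordinates of \<open>e\<close> with respect to \<open>s\<close>.\<close>
  define \<gamma> where "\<gamma> e = t (\<alpha> (p e)) + i (\<beta> (the_inv i (e - s (p e))))" for e
  have \<gamma>: "\<gamma> (s x + i h) = t (\<alpha> x) + i (\<beta> h)" for x h
    by (simp add: \<gamma>_def)
  have s0: "s 0 = 0" and t0: "t 0 = 0" by (simp_all add: s_simps t.s_simps)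
  have dist: "scl E c (e + f) = scl E c e + scl E c f" for c e f
    using E.vs by (rule vector_space.vector_space_assms(1))
  have "\<gamma> (e + f) = \<gamma> e + \<gamma> f" for e f
  proof -
    obtain x h where e: "e = s x + i h" by (rule decompose)
    obtain y k where f: "f = s y + i k" by (rule decompose)
    have "e + f = s (x + y) + i (h + k)" by (simp add: e f s_simps algebra_simps)
    then have "\<gamma> (e + f) = t (\<alpha> (x + y)) + i (\<beta> (h + k))" by (simp only: \<gamma>)
    then show ?thesis unfolding e f \<gamma> by (simp add: \<alpha>s \<beta>s t.s_simps algebra_simps)
  qed
  moreover have "\<gamma> (scl E c e) = scl E c (\<gamma> e)" for c e
  proof -
    obtain x h where e: "e = s x + i h" by (rule decompose)
    have "scl E c e = s (scl G c x) + i (scl H c h)" by (simp add: e dist s_simps)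
    then have "\<gamma> (scl E c e) = t (\<alpha> (scl G c x)) + i (\<beta> (scl H c h))" by (simp only: \<gamma>)
    then show ?thesis unfolding e \<gamma> by (simp add: \<alpha>s \<beta>s t.s_simps dist)
  qed
  moreover have "\<gamma> (lie E e f) = lie E (\<gamma> e) (\<gamma> f)" for e f
  proof -
    obtain x h where e: "e = s x + i h" by (rule decompose)
    obtain y k where f: "f = s y + i k" by (rule decompose)
    show ?thesis
      unfolding e f lie_coordinates \<gamma> t.lie_coordinates
      by (simp only: \<alpha>s \<beta>s tchi tpsi)
  qed
  moreover have "\<gamma> (nij E e) = nij E (\<gamma> e)" for e
  proof -
    obtain x h where e: "e = s x + i h" by (rule decompose)
    show ?thesis
      unfolding e nij_coordinates \<gamma> t.nij_coordinates by (simp only: \<alpha>s \<beta>s teff)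
  qed
  ultimately have hom: "nij_lie_hom E E \<gamma>"
    using E.vs by (simp add: nij_lie_hom_def linear_map_iff)
  have "inj \<gamma>"
  proof (rule injI)
    fix e f assume eq: "\<gamma> e = \<gamma> f"
    obtain x h where e: "e = s x + i h" by (rule decompose)
    obtain y k where f: "f = s y + i k" by (rule decompose)
    show "e = f"
      using eq \<alpha>(2) \<beta>(2) unfolding e f \<gamma> t.coordinates_eq_iff coordinates_eq_iff
      by (simp add: bij_is_inj inj_eq)
  qed
  moreover have "surj \<gamma>"
  unfolding surj_def
  proof (rule allI)
    fix e
    obtain x h where e: "e = t x + i h" by (rule t.decompose)
    obtain y k where "x = \<alpha> y" "h = \<beta> k" using \<alpha>(2) \<beta>(2) by (meson bij_pointE)
    then have "e = \<gamma> (s y + i k)" by (simp add: e \<gamma>)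
    then show "\<exists>f. e = \<gamma> f" ..
  qed
  moreover have \<gamma>i: "\<gamma> (i h) = i (\<beta> h)" for h
    using \<gamma>[of 0 h] by (simp add: s0 t0 \<alpha>s)
  then have "\<gamma> ` range i = i ` range \<beta>" by (simp add: image_image)
  then have "\<gamma> ` range i = range i" using \<beta>(2) by (simp add: bij_is_surj)
  ultimately have mem: "\<gamma> \<in> carrier (Aut_h E i)" using hom by (simp add: carrier_Aut_h bij_def)
  have "p (\<gamma> e) = \<alpha> (p e)" for e by (simp add: \<gamma>_def)
  with mem \<gamma>i have "tau i p s \<gamma> = (\<beta>, \<alpha>)" by (intro tau_eqI)
  with mem show ?thesis by blast
qed

lemma inducible_iff:
  assumes "ba \<in> carrier (Aut H \<times>\<times> Aut G)"
  shows "ba \<in> tau i p s ` carrier (Aut_h E i) \<longleftrightarrow>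
    (twist ba (ext_cocycle E G i s), ext_cocycle E G i s) \<in> nab_equiv G H"
proof -
  obtain \<beta> \<alpha> where ba: "ba = (\<beta>, \<alpha>)" by (cases ba)
  show ?thesis
    unfolding equivalent_cocycle_iff
  proof
    assume "ba \<in> tau i p s ` carrier (Aut_h E i)"
    then obtain \<gamma> where "\<gamma> \<in> carrier (Aut_h E i)" "ba = tau i p s \<gamma>" by (rule imageE)
    then show "\<exists>t. section_of E G p t \<and> twist ba (ext_cocycle E G i s) = ext_cocycle E G i t"
      using twist_tau by simp
  next
    assume "\<exists>t. section_of E G p t \<and> twist ba (ext_cocycle E G i s) = ext_cocycle E G i t"
    then obtain t where "section_of E G p t" "twist (\<beta>, \<alpha>) (ext_cocycle E G i s) = ext_cocycle E G i t"
      unfolding ba by (elim exE conjE)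
    moreover have "nij_lie_hom H H \<beta>" "bij \<beta>" "nij_lie_hom G G \<alpha>" "bij \<alpha>"
      using assms by (simp_all add: ba)
    ultimately obtain \<gamma> where "\<gamma> \<in> carrier (Aut_h E i)" "tau i p s \<gamma> = (\<beta>, \<alpha>)"
      using lift_pair by blast
    then show "ba \<in> tau i p s ` carrier (Aut_h E i)"
      unfolding ba by (intro image_eqI) simp_all
  qed
qed

lemma twist_ext_cocycle:
  assumes "ba \<in> carrier (Aut H \<times>\<times> Aut G)"
  shows "twist ba (ext_cocycle E G i s) \<in> nab_cocycles G H"
  using assms twist_cocycle[OF _ _ _ _ ext_cocycle_cocycle] by (cases ba) simp

lemma wells_eq_zero_iff:
  assumes "ba \<in> carrier (Aut H \<times>\<times> Aut G)"
  shows "wells H E G i s ba = wells_zero H E G i s \<longleftrightarrow>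
    (twist ba (ext_cocycle E G i s), ext_cocycle E G i s) \<in> nab_equiv G H"
  unfolding wells_def wells_zero_def nab_class_def
  using eq_equiv_class_iff[OF nab_equiv_equiv[OF H.nij_alg G.nij_alg]
      twist_ext_cocycle[OF assms] ext_cocycle_cocycle] .

lemma wells_in_H2: "wells H E G i s \<in> carrier (Aut H \<times>\<times> Aut G) \<rightarrow> H2_nab G H"
  unfolding wells_def nab_class_def H2_nab_def
  by (intro funcsetI quotientI twist_ext_cocycle)

end

theorem theorem4p5:
  fixes H :: "('k::field, 'h::ab_group_add) nij_lie"
    and E :: "('k, 'e::ab_group_add) nij_lie"
    and G :: "('k, 'g::ab_group_add) nij_lie"
    and i :: "'h \<Rightarrow> 'e" and p :: "'e \<Rightarrow> 'g"
  assumes "nij_extension H E G i p"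
  shows "equiv (nab_cocycles G H) (nab_equiv G H) \<and>
    (\<exists>s. section_of E G p s) \<and>
    (\<forall>s s'. section_of E G p s \<and> section_of E G p s' \<longrightarrow>
      group_hom (Aut_hg E i p s) (Aut_h E i) (\<lambda>\<gamma>. \<gamma>) \<and>
      group_hom (Aut_h E i) (Aut H \<times>\<times> Aut G) (tau i p s) \<and>
      wells H E G i s' \<in> carrier (Aut H \<times>\<times> Aut G) \<rightarrow> H2_nab G H \<and>
      (\<forall>ba \<in> carrier (Aut H \<times>\<times> Aut G). wells H E G i s' ba = wells_zero H E G i s' \<longleftrightarrow>
        (twist ba (ext_cocycle E G i s'), ext_cocycle E G i s') \<in> nab_equiv G H) \<and>
      inj_on (\<lambda>\<gamma>. \<gamma>) (carrier (Aut_hg E i p s)) \<and>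
      (\<lambda>\<gamma>. \<gamma>) ` carrier (Aut_hg E i p s) = kernel (Aut_h E i) (Aut H \<times>\<times> Aut G) (tau i p s) \<and>
      tau i p s ` carrier (Aut_h E i) =
        {ba \<in> carrier (Aut H \<times>\<times> Aut G). wells H E G i s' ba = wells_zero H E G i s'})"
proof -
  interpret extension H E G i p by unfold_locales (rule assms)
  show ?thesis
  proof (intro conjI allI impI section_exists nab_equiv_equiv[OF H.nij_alg G.nij_alg])
    fix s s' assume ss: "section_of E G p s \<and> section_of E G p s'"
    interpret s: split_extension H E G i p s by unfold_locales (use ss in blast)
    interpret s': split_extension H E G i p s' by unfold_locales (use ss in blast)
    show "group_hom (Aut_hg E i p s) (Aut_h E i) (\<lambda>\<gamma>. \<gamma>)" by (rule s.Aut_hg_inclusion)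
    show "group_hom (Aut_h E i) (Aut H \<times>\<times> Aut G) (tau i p s)" by (rule s.tau_group_hom)
    show "wells H E G i s' \<in> carrier (Aut H \<times>\<times> Aut G) \<rightarrow> H2_nab G H" by (rule s'.wells_in_H2)
    show "\<forall>ba \<in> carrier (Aut H \<times>\<times> Aut G). wells H E G i s' ba = wells_zero H E G i s' \<longleftrightarrow>
        (twist ba (ext_cocycle E G i s'), ext_cocycle E G i s') \<in> nab_equiv G H"
      using s'.wells_eq_zero_iff by blast
    show "inj_on (\<lambda>\<gamma>. \<gamma>) (carrier (Aut_hg E i p s))" by simp
    show "(\<lambda>\<gamma>. \<gamma>) ` carrier (Aut_hg E i p s) = kernel (Aut_h E i) (Aut H \<times>\<times> Aut G) (tau i p s)"
      by (simp add: s.carrier_Aut_hg)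
    \<comment> \<open>The Wells map is formed with \<open>s'\<close>, so \<open>\<tau>\<close> has to be rewritten in terms of \<open>s'\<close> as well.\<close>
    have "tau i p s ` carrier (Aut_h E i) = tau i p s' ` carrier (Aut_h E i)"
      by (rule image_cong[OF refl s'.tau_independent[OF _ conjunct1[OF ss]]])
    also have "\<dots> = {ba \<in> carrier (Aut H \<times>\<times> Aut G). wells H E G i s' ba = wells_zero H E G i s'}"
      using s'.tau_Aut s'.inducible_iff s'.wells_eq_zero_iff by blast
    finally show "tau i p s ` carrier (Aut_h E i) =
        {ba \<in> carrier (Aut H \<times>\<times> Aut G). wells H E G i s' ba = wells_zero H E G i s'}" .
  qed
qed

end
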